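(* Let $\alpha\in\mathbb{R}$, $\alpha\neq 0,1$. Then the bilinear estimate $$\|uv\|_{L^2(\mathbb{R}^2)}\lesssim \|u\|_{X^{\alpha}_{-\frac12,\frac12-2\epsilon}}\|v\|_{X_{-\frac12,\frac12+\epsilon}}$$ fails to hold for all $\epsilon>0$.
   Context: Write $\langle\cdot\rangle:=1+|\cdot|$ and let $\tilde f(\tau,\xi)$ denote the space-time Fourier transform of $f(t,x)$. For $s,b\in\mathbb{R}$, $X^{\alpha}_{s,b}$ is the completion of the Schwartz class $\mathcal{S}(\mathbb{R}^2)$ under the norm $$\|f\|_{X^{\alpha}_{s,b}}:=\|\langle\xi\rangle^s\langle\tau-\alpha\xi^3\rangle^b\tilde f(\tau,\xi)\|_{L^2_{\tau,\xi}},$$ and $X_{s,b}:=X^1_{s,b}$. An estimate $A\lesssim B$ "holds" if there is a constant $C>0$, independent of the functions involved, such that $A\le CB$ for all (Schwartz) functions. "Fails to hold for all $\epsilon>0$" means that for every $\epsilon>0$ no such constant exists. *)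

theory Defs
  imports "HOL-Analysis.Analysis"
begin

text \<open>Functions on space-time are functions of the pair \<open>(t, x)\<close>; their Fourier transforms are
  functions of the pair \<open>(\<tau>, \<xi>)\<close>.\<close>

text \<open>The witness \<open>D i j\<close> is the partial derivative \<open>\<partial>\<^sub>t\<^sup>i \<partial>\<^sub>x\<^sup>j f\<close>. Since every \<open>D i j\<close> is required to be
  Frechet differentiable everywhere with partial derivatives \<open>D (Suc i) j\<close> and \<open>D i (Suc j)\<close>,
  such a family exists (and is then unique) exactly if \<open>f\<close> is smooth.\<close>

definition schwartz :: "(real \<times> real \<Rightarrow> complex) \<Rightarrow> bool" where
  "schwartz f \<longleftrightarrow>
    (\<exists>D :: nat \<Rightarrow> nat \<Rightarrow> real \<times> real \<Rightarrow> complex.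
      D 0 0 = f \<and>
      (\<forall>i j p. (D i j has_derivative
        (\<lambda>(h, k). h *\<^sub>R D (Suc i) j p + k *\<^sub>R D i (Suc j) p)) (at p)) \<and>
      (\<forall>m n i j. bounded (range (\<lambda>(t, x). (t ^ m * x ^ n) *\<^sub>R D i j (t, x)))))"

text \<open>The unnormalised transform with kernel \<open>exp (- \<i> (t \<tau> + x \<xi>))\<close>; a different normalising factor
  only rescales the norms below by a constant.\<close>

definition fourier :: "(real \<times> real \<Rightarrow> complex) \<Rightarrow> real \<times> real \<Rightarrow> complex" where
  "fourier f = (\<lambda>(\<tau>, \<xi>). \<integral>(t, x). cis (- (t * \<tau> + x * \<xi>)) * f (t, x) \<partial>lborel)"

definition bracket :: "real \<Rightarrow> real" where
  "bracket y = 1 + \<bar>y\<bar>"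

text \<open>Extended-real valued, so that a function that is not square integrable has norm \<open>\<infinity>\<close>.\<close>

definition L2_norm :: "(real \<times> real \<Rightarrow> complex) \<Rightarrow> ennreal" where
  "L2_norm f =
    (let I = \<integral>\<^sup>+ z. ennreal ((cmod (f z))\<^sup>2) \<partial>lborel
     in if I = \<infinity> then \<infinity> else ennreal (sqrt (enn2real I)))"

definition X_norm :: "real \<Rightarrow> real \<Rightarrow> real \<Rightarrow> (real \<times> real \<Rightarrow> complex) \<Rightarrow> ennreal" where
  "X_norm \<alpha> s b f =
    L2_norm (\<lambda>(\<tau>, \<xi>).
      complex_of_real (bracket \<xi> powr s * bracket (\<tau> - \<alpha> * \<xi> ^ 3) powr b) * fourier f (\<tau>, \<xi>))"

end

theory Submission
  imports Defs "HOL-Probability.Characteristic_Functions"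
begin

text \<open>
  For two packets of frequency about \<open>N\<close> whose modulations \<open>\<tau> - \<alpha> \<xi>\<^sup>3\<close> and \<open>\<tau> - \<xi>\<^sup>3\<close> are of order
  \<open>N\<^sup>2\<close>, the estimate needs the two modulation weights to multiply up to at least \<open>N\<^sup>2\<close>, that is,
  exponents that add up to at least \<open>1\<close>. But \<open>(1/2 - 2 \<epsilon>) + (1/2 + \<epsilon>) = 1 - \<epsilon>\<close>.

  Concretely, take Gaussian wave packets of frequency \<open>N\<close>, of width \<open>1\<close> in space and \<open>N\<^sup>-\<^sup>2\<close>
  in time, that oscillate in time with frequencies \<open>\<alpha> N\<^sup>3\<close> and \<open>N\<^sup>3\<close>. Up to time \<open>N\<^sup>-\<^sup>2\<close> neither the
  group velocity (of order \<open>N\<^sup>2\<close>) nor the dispersion moves a packet by more than its width, so each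
  packet has modulation of order \<open>N\<^sup>2\<close>. Hence its norm with exponents \<open>(- 1/2, b)\<close> is of order at
  most \<open>N powr (- 1/2) * N powr (2 b) * N\<^sup>-\<^sup>1\<close> (lemma \<open>X_norm_wave_le\<close>), which multiplies up to
  \<open>N powr (- 1 - 2 \<epsilon>)\<close>. The modulus of the product is a Gaussian whose \<open>L\<^sup>2\<close> norm
  is a constant times \<open>N\<^sup>-\<^sup>1\<close> (lemma \<open>L2_norm_wave_mult\<close>), so an estimate would bound \<open>N powr (2 \<epsilon>)\<close>.

  This count needs \<open>1/2 - 2 \<epsilon> > 0\<close>. If \<open>1/2 - 2 \<epsilon> \<le> 0\<close>, the modulation weight on \<open>u\<close> is at most \<open>1\<close>,
  and the frequency weight alone is fatal: keep \<open>v\<close> fixed and let \<open>u\<close> be a packet of unit size in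
  space and time with frequency \<open>N\<close>; its norm is of order at most \<open>N powr (- 1/2)\<close>, whereas \<open>\<bar>u v\<bar>\<close>
  does not depend on \<open>N\<close>.
\<close>

section \<open>Gaussian bounds and integrals\<close>

lemma power_over_fact_le_exp:
  fixes x :: real
  assumes "0 \<le> x"
  shows "x ^ n / fact n \<le> exp x"
proof -
  have "(\<Sum>k\<in>{n}. x ^ k /\<^sub>R fact k) \<le> (\<Sum>k. x ^ k /\<^sub>R fact k)"
    using assms by (intro sum_le_suminf summable_exp_generic) auto
  then show ?thesis
    by (simp add: exp_def divide_inverse mult.commute)
qed

text \<open>The constant \<open>exp 2\<close> comes from \<open>1 + \<bar>y\<bar> - y\<^sup>2 / 4 = 2 - (\<bar>y\<bar> / 2 - 1)\<^sup>2\<close>.\<close>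

lemma power_times_gaussian_le:
  fixes y :: real
  shows "(1 + \<bar>y\<bar>) ^ n * exp (- (y\<^sup>2 / 4)) \<le> fact n * exp 2"
proof -
  have "(1 + \<bar>y\<bar>) ^ n \<le> fact n * exp (1 + \<bar>y\<bar>)"
    using power_over_fact_le_exp[of "1 + \<bar>y\<bar>" n] by (simp add: field_simps)
  then have "(1 + \<bar>y\<bar>) ^ n * exp (- (y\<^sup>2 / 4)) \<le> fact n * exp (1 + \<bar>y\<bar>) * exp (- (y\<^sup>2 / 4))"
    by (rule mult_right_mono) simp
  also have "\<dots> = fact n * exp (1 + \<bar>y\<bar> - y\<^sup>2 / 4)"
    by (simp add: mult_exp_exp)
  also have "1 + \<bar>y\<bar> - y\<^sup>2 / 4 \<le> 2"
    using zero_le_power2[of "\<bar>y\<bar> / 2 - 1"] by (simp add: power2_eq_square algebra_simps)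
  finally show ?thesis by simp
qed

lemma bracket_ge_1: "1 \<le> bracket y"
  by (simp add: bracket_def)

text \<open>A polynomial weight costs no more than half of a Gaussian exponent. The other half is left over to
  keep the bound square integrable.\<close>

lemma bracket_powr_times_gaussian_le:
  "\<exists>A>0. \<forall>y. bracket y powr p * exp (- (y\<^sup>2 / 2)) \<le> A * exp (- (y\<^sup>2 / 4))"
proof -
  obtain n :: nat where n: "p \<le> real n"
    using real_arch_simple by blast
  have "bracket y powr p * exp (- (y\<^sup>2 / 2)) \<le> fact n * exp 2 * exp (- (y\<^sup>2 / 4))" for y
  proof -
    have "bracket y powr p \<le> bracket y powr real n"
      using n bracket_ge_1 by (intro powr_mono) auto
    also have "\<dots> = (1 + \<bar>y\<bar>) ^ n"
      using bracket_ge_1[of y] by (simp add: powr_realpow bracket_def)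
    finally have "bracket y powr p * exp (- (y\<^sup>2 / 4)) \<le> fact n * exp 2"
      using power_times_gaussian_le[of y n] by (meson exp_ge_zero mult_right_mono order_trans)
    then have "bracket y powr p * exp (- (y\<^sup>2 / 4)) * exp (- (y\<^sup>2 / 4)) \<le> fact n * exp 2 * exp (- (y\<^sup>2 / 4))"
      by (rule mult_right_mono) simp
    then show ?thesis
      by (simp add: mult.assoc mult_exp_exp)
  qed
  then show ?thesis
    by (intro exI[of _ "fact n * exp 2"]) auto
qed

lemma nn_integral_gaussian:
  fixes \<mu> \<sigma> :: real
  assumes "0 < \<sigma>"
  shows "(\<integral>\<^sup>+ x. ennreal (exp (- ((x - \<mu>)\<^sup>2 / (2 * \<sigma>\<^sup>2)))) \<partial>lborel) = ennreal (sqrt (2 * pi) * \<sigma>)"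
proof -
  have "(\<integral>\<^sup>+ x. ennreal (exp (- ((x - \<mu>)\<^sup>2 / (2 * \<sigma>\<^sup>2)))) \<partial>lborel)
      = (\<integral>\<^sup>+ x. ennreal (sqrt (2 * pi) * \<sigma> * normal_density \<mu> \<sigma> x) \<partial>lborel)"
    using assms by (simp add: normal_density_def real_sqrt_mult)
  also have "\<dots> = ennreal (\<integral> x. sqrt (2 * pi) * \<sigma> * normal_density \<mu> \<sigma> x \<partial>lborel)"
    using assms by (intro nn_integral_eq_integral) (auto intro!: integrable_mult_right)
  also have "\<dots> = ennreal (sqrt (2 * pi) * \<sigma>)"
    using assms by simp
  finally show ?thesis .
qed

lemma nn_integral_gaussian_product:
  fixes \<mu> \<nu> \<sigma> \<rho> :: real
  assumes "0 < \<sigma>" "0 < \<rho>"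
  shows "(\<integral>\<^sup>+ (t, x). ennreal (exp (- ((t - \<mu>)\<^sup>2 / (2 * \<sigma>\<^sup>2))) * exp (- ((x - \<nu>)\<^sup>2 / (2 * \<rho>\<^sup>2)))) \<partial>lborel)
    = ennreal (2 * pi * \<sigma> * \<rho>)"
proof -
  let ?f = "\<lambda>t. ennreal (exp (- ((t - \<mu>)\<^sup>2 / (2 * \<sigma>\<^sup>2))))"
  let ?g = "\<lambda>x. ennreal (exp (- ((x - \<nu>)\<^sup>2 / (2 * \<rho>\<^sup>2))))"
  have "(\<integral>\<^sup>+ (t, x). ennreal (exp (- ((t - \<mu>)\<^sup>2 / (2 * \<sigma>\<^sup>2))) * exp (- ((x - \<nu>)\<^sup>2 / (2 * \<rho>\<^sup>2)))) \<partial>lborel)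
      = (\<integral>\<^sup>+ z. ?f (fst z) * ?g (snd z) \<partial>(lborel \<Otimes>\<^sub>M lborel))"
    by (simp add: lborel_prod case_prod_unfold ennreal_mult)
  also have "\<dots> = (\<integral>\<^sup>+ t. \<integral>\<^sup>+ x. ?f t * ?g x \<partial>lborel \<partial>lborel)"
    by (subst lborel.nn_integral_fst[symmetric]) auto
  also have "\<dots> = (\<integral>\<^sup>+ t. ?f t * ennreal (sqrt (2 * pi) * \<rho>) \<partial>lborel)"
    using assms by (subst nn_integral_cmult) (auto simp: nn_integral_gaussian)
  also have "\<dots> = ennreal (sqrt (2 * pi) * \<sigma>) * ennreal (sqrt (2 * pi) * \<rho>)"
    using assms by (subst nn_integral_multc) (auto simp: nn_integral_gaussian)
  also have "\<dots> = ennreal (2 * pi * \<sigma> * \<rho>)"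
    using assms by (simp add: ennreal_mult[symmetric] mult_ac)
  finally show ?thesis .
qed

section \<open>Gaussian wave packets on the line\<close>

definition packet :: "real \<Rightarrow> real \<Rightarrow> real \<Rightarrow> complex" where
  "packet a c t = cis (c * t) * of_real (exp (- ((a * t)\<^sup>2 / 2)))"

text \<open>As the exponential of a quadratic polynomial the packet extends to an entire function; this is the
  form that is convenient for differentiation.\<close>

lemma packet_eq_exp: "packet a c t = exp (\<i> * of_real c * of_real t - of_real a ^ 2 * of_real t ^ 2 / 2)"
  by (simp add: packet_def cis_conv_exp exp_of_real[symmetric] mult_exp_exp power_mult_distrib
      algebra_simps)

lemma norm_packet: "cmod (packet a c t) = exp (- ((a * t)\<^sup>2 / 2))"
  by (simp add: packet_def norm_mult)

text \<open>After rescaling by \<open>a\<close>, this is the characteristic function of the standard normal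
  distribution at \<open>(c - s) / a\<close>.\<close>

lemma fourier_transform_packet:
  fixes a c s :: real
  assumes a: "0 < a"
  shows "(\<integral> t. cis (- (s * t)) * packet a c t \<partial>lborel)
    = of_real (sqrt (2 * pi) / a * exp (- (((s - c) / a)\<^sup>2 / 2)))"
proof -
  let ?r = "(c - s) / a"
  have "(\<integral> t. cis (- (s * t)) * packet a c t \<partial>lborel)
      = \<bar>1 / a\<bar> *\<^sub>R (\<integral> x. cis (- (s * (0 + 1 / a * x))) * packet a c (0 + 1 / a * x) \<partial>lborel)"
    using a by (intro lborel_integral_real_affine) auto
  also have "(\<integral> x. cis (- (s * (0 + 1 / a * x))) * packet a c (0 + 1 / a * x) \<partial>lborel)
      = (\<integral> x. of_real (sqrt (2 * pi)) * (std_normal_density x *\<^sub>R iexp (?r * x)) \<partial>lborel)"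
  proof (intro Bochner_Integration.integral_cong refl)
    fix x :: real
    have "cis (- (s * (0 + 1 / a * x))) * packet a c (0 + 1 / a * x)
      = cis (?r * x) * of_real (exp (- (x\<^sup>2 / 2)))"
      using a by (simp add: packet_def cis_mult mult.assoc[symmetric] diff_divide_distrib algebra_simps)
    also have "\<dots> = of_real (sqrt (2 * pi)) * (std_normal_density x *\<^sub>R iexp (?r * x))"
      by (simp add: std_normal_density_def cis_conv_exp scaleR_conv_of_real)
    finally show "cis (- (s * (0 + 1 / a * x))) * packet a c (0 + 1 / a * x)
      = of_real (sqrt (2 * pi)) * (std_normal_density x *\<^sub>R iexp (?r * x))" .
  qed
  also have "\<dots> = of_real (sqrt (2 * pi)) * char std_normal_distribution ?r"
    by (simp only: integral_mult_right_zero char_def) (subst integral_density, auto)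
  also have "\<dots> = of_real (sqrt (2 * pi) * exp (- (?r\<^sup>2 / 2)))"
    by (simp add: char_std_normal_distribution)
  finally show ?thesis
    using a by (simp add: scaleR_conv_of_real power_divide power2_commute[of c s])
qed

lemma packet_measurable [measurable]: "packet a c \<in> borel_measurable borel"
  unfolding packet_def[abs_def]
  by (intro borel_measurable_continuous_onI continuous_intros) simp

lemma packet_integrable:
  assumes "0 < a"
  shows "integrable lborel (packet a c)"
proof (rule integrableI_bounded)
  have "(\<integral>\<^sup>+ t. ennreal (cmod (packet a c t)) \<partial>lborel) = (\<integral>\<^sup>+ t. ennreal (exp (- ((t - 0)\<^sup>2 / (2 * (1 / a)\<^sup>2)))) \<partial>lborel)"
    by (simp add: norm_packet power_mult_distrib power_divide mult.commute)
  also have "\<dots> < \<infinity>"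
    using assms by (subst nn_integral_gaussian) auto
  finally show "(\<integral>\<^sup>+ t. ennreal (cmod (packet a c t)) \<partial>lborel) < \<infinity>" .
qed simp

text \<open>The derivatives of a packet are polynomials times the packet; the linear polynomial in the
  recursion is the logarithmic derivative \<open>\<i> c - a\<^sup>2 t\<close> of the packet.\<close>

primrec packet_deriv_poly :: "real \<Rightarrow> real \<Rightarrow> nat \<Rightarrow> complex poly" where
  "packet_deriv_poly a c 0 = 1"
| "packet_deriv_poly a c (Suc i) =
    pderiv (packet_deriv_poly a c i) + [:\<i> * of_real c, - (of_real a ^ 2):] * packet_deriv_poly a c i"

definition packet_deriv :: "real \<Rightarrow> real \<Rightarrow> nat \<Rightarrow> real \<Rightarrow> complex" where
  "packet_deriv a c i t = poly (packet_deriv_poly a c i) (of_real t) * packet a c t"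

lemma packet_deriv_0: "packet_deriv a c 0 = packet a c"
  by (simp add: packet_deriv_def fun_eq_iff)

lemma packet_deriv_has_derivative:
  "(packet_deriv a c i has_vector_derivative packet_deriv a c (Suc i) t) (at t)"
proof -
  have "((\<lambda>z. poly (packet_deriv_poly a c i) z * exp (\<i> * of_real c * z - of_real a ^ 2 * z ^ 2 / 2))
      has_field_derivative packet_deriv a c (Suc i) t) (at (of_real t))"
    unfolding packet_deriv_def packet_eq_exp
    by (auto intro!: derivative_eq_intros simp: algebra_simps)
  from has_vector_derivative_real_field[OF this] show ?thesis
    by (simp add: packet_deriv_def[abs_def] packet_eq_exp)
qed

text \<open>The extra power \<open>t ^ m\<close> makes the induction on the polynomial go through, since
  \<open>t ^ m * pCons d p\<close> is \<open>d * t ^ m\<close> plus \<open>t ^ Suc m * p\<close>.\<close>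

lemma poly_times_packet_bounded:
  assumes a: "0 < a"
  shows "\<exists>K. \<forall>t. cmod (of_real t ^ m * (poly p (of_real t) * packet a c t)) \<le> K"
proof (induction p arbitrary: m)
  case 0
  show ?case by (intro exI[of _ 0]) simp
next
  case (pCons d p)
  obtain K where K: "\<And>t. cmod (of_real t ^ Suc m * (poly p (of_real t) * packet a c t)) \<le> K"
    using pCons.IH by blast
  have mono: "\<bar>t\<bar> ^ m * cmod (packet a c t) \<le> fact m * exp 2 / a ^ m" for t
  proof -
    have "(a * \<bar>t\<bar>) ^ m * exp (- ((a * t)\<^sup>2 / 2)) \<le> (1 + \<bar>a * t\<bar>) ^ m * exp (- ((a * t)\<^sup>2 / 4))"
      using a by (intro mult_mono power_mono) (auto simp: abs_mult)
    also have "\<dots> \<le> fact m * exp 2"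
      by (rule power_times_gaussian_le)
    finally show ?thesis
      using a by (simp add: norm_packet field_simps power_mult_distrib)
  qed
  have "cmod (of_real t ^ m * (poly (pCons d p) (of_real t) * packet a c t))
      \<le> cmod d * (fact m * exp 2 / a ^ m) + K" for t
  proof -
    have "of_real t ^ m * (poly (pCons d p) (of_real t) * packet a c t)
      = d * (of_real t ^ m * packet a c t) + of_real t ^ Suc m * (poly p (of_real t) * packet a c t)"
      by (simp add: algebra_simps)
    also have "cmod \<dots> \<le> cmod (d * (of_real t ^ m * packet a c t)) + K"
      using K by (meson add_left_mono norm_triangle_ineq order_trans)
    also have "cmod (d * (of_real t ^ m * packet a c t)) \<le> cmod d * (fact m * exp 2 / a ^ m)"
      unfolding norm_mult norm_power norm_of_real using mono[of t] by (intro mult_left_mono) auto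
    finally show ?thesis by simp
  qed
  then show ?case by blast
qed

section \<open>Gaussian wave packets on space-time\<close>

text \<open>Width \<open>1 / M\<close> in time and \<open>1\<close> in space, centred in Fourier space at \<open>(\<omega>, N)\<close>.\<close>

definition wave :: "real \<Rightarrow> real \<Rightarrow> real \<Rightarrow> real \<times> real \<Rightarrow> complex" where
  "wave M N \<omega> = (\<lambda>(t, x). packet M \<omega> t * packet 1 N x)"

lemma schwartz_wave:
  assumes M: "0 < M"
  shows "schwartz (wave M N \<omega>)"
  unfolding schwartz_def
proof (intro exI[of _ "\<lambda>i j (t, x). packet_deriv M \<omega> i t * packet_deriv 1 N j x"] conjI allI)
  let ?D = "\<lambda>i j (t, x). packet_deriv M \<omega> i t * packet_deriv 1 N j x"
  show "?D 0 0 = wave M N \<omega>"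
    by (simp add: wave_def packet_deriv_0)
  fix i j
  show "(?D i j has_derivative (\<lambda>(h, k). h *\<^sub>R ?D (Suc i) j p + k *\<^sub>R ?D i (Suc j) p)) (at p)" for p
  proof -
    have "((\<lambda>q. packet_deriv M \<omega> i (fst q)) has_derivative (\<lambda>q. fst q *\<^sub>R packet_deriv M \<omega> (Suc i) (fst p))) (at p)"
      by (rule has_derivative_compose[OF has_derivative_fst[OF has_derivative_ident]
          packet_deriv_has_derivative[unfolded has_vector_derivative_def]])
    moreover have "((\<lambda>q. packet_deriv 1 N j (snd q)) has_derivative (\<lambda>q. snd q *\<^sub>R packet_deriv 1 N (Suc j) (snd p))) (at p)"
      by (rule has_derivative_compose[OF has_derivative_snd[OF has_derivative_ident]
          packet_deriv_has_derivative[unfolded has_vector_derivative_def]])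
    ultimately have "((\<lambda>q. packet_deriv M \<omega> i (fst q) * packet_deriv 1 N j (snd q)) has_derivative
       (\<lambda>q. packet_deriv M \<omega> i (fst p) * (snd q *\<^sub>R packet_deriv 1 N (Suc j) (snd p))
          + (fst q *\<^sub>R packet_deriv M \<omega> (Suc i) (fst p)) * packet_deriv 1 N j (snd p))) (at p)"
      by (rule has_derivative_mult)
    then show ?thesis
      by (simp add: case_prod_unfold add.commute)
  qed
  show "bounded (range (\<lambda>(t, x). (t ^ m * x ^ n) *\<^sub>R ?D i j (t, x)))" for m n
  proof -
    obtain K where K: "\<And>t. cmod (of_real t ^ m * packet_deriv M \<omega> i t) \<le> K"
      using poly_times_packet_bounded[OF M] unfolding packet_deriv_def by blast
    obtain L where L: "\<And>x. cmod (of_real x ^ n * packet_deriv 1 N j x) \<le> L"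
      using poly_times_packet_bounded[OF zero_less_one] unfolding packet_deriv_def by blast
    have "cmod ((t ^ m * x ^ n) *\<^sub>R (packet_deriv M \<omega> i t * packet_deriv 1 N j x)) \<le> K * L" for t x
    proof -
      have "cmod ((t ^ m * x ^ n) *\<^sub>R (packet_deriv M \<omega> i t * packet_deriv 1 N j x))
        = cmod (of_real t ^ m * packet_deriv M \<omega> i t) * cmod (of_real x ^ n * packet_deriv 1 N j x)"
        by (simp add: norm_mult norm_power abs_mult power_abs)
      also have "\<dots> \<le> K * L"
        using K L by (intro mult_mono) (auto intro: order_trans[OF norm_ge_zero])
      finally show ?thesis .
    qed
    then show ?thesis
      unfolding bounded_iff by (intro exI[of _ "K * L"]) auto
  qed
qed

lemma fourier_wave:
  assumes M: "0 < M"
  shows "fourier (wave M N \<omega>) (\<tau>, \<xi>)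
    = of_real (2 * pi / M * exp (- (((\<tau> - \<omega>) / M)\<^sup>2 / 2)) * exp (- ((\<xi> - N)\<^sup>2 / 2)))"
proof -
  let ?f = "\<lambda>t. cis (- (\<tau> * t)) * packet M \<omega> t" and ?g = "\<lambda>x. cis (- (\<xi> * x)) * packet 1 N x"
  have int: "integrable lborel (\<lambda>t. cis (- (s * t)) * packet a c t)" if "0 < a" for s a c
    using packet_integrable[OF that, of c]
    by (rule Bochner_Integration.integrable_bound)
       (auto simp: norm_mult intro!: borel_measurable_times packet_measurable
          borel_measurable_continuous_onI[of "\<lambda>t. cis (- (s * t))"] continuous_intros)
  have split: "cis (- (fst p * \<tau> + snd p * \<xi>)) * wave M N \<omega> p = ?f (fst p) * ?g (snd p)" for p
  proof -
    have "cis (- (fst p * \<tau> + snd p * \<xi>)) = cis (- (\<tau> * fst p)) * cis (- (\<xi> * snd p))"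
      by (simp add: cis_mult mult.commute)
    then show ?thesis
      by (simp add: wave_def case_prod_unfold)
  qed
  have "fourier (wave M N \<omega>) (\<tau>, \<xi>) = (\<integral> z. ?f (fst z) * ?g (snd z) \<partial>(lborel \<Otimes>\<^sub>M lborel))"
    by (simp only: fourier_def case_prod_unfold fst_conv snd_conv prod.collapse split lborel_prod)
  also have "\<dots> = (\<integral> t. ?f t \<partial>lborel) * (\<integral> x. ?g x \<partial>lborel)"
  proof -
    have "integrable (lborel \<Otimes>\<^sub>M lborel) (\<lambda>z. ?f (fst z) * ?g (snd z))"
    proof (rule lborel_pair.Fubini_integrable)
      show "integrable lborel (\<lambda>t. \<integral> x. norm (?f (fst (t, x)) * ?g (snd (t, x))) \<partial>lborel)"
        using integrable_norm[OF int[OF M]] by (simp add: norm_mult)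
      show "AE t in lborel. integrable lborel (\<lambda>x. ?f (fst (t, x)) * ?g (snd (t, x)))"
        using int[OF zero_less_one] by simp
      show "(\<lambda>z. ?f (fst z) * ?g (snd z)) \<in> borel_measurable (lborel \<Otimes>\<^sub>M lborel)"
        by (rule borel_measurable_times[OF
              measurable_compose[OF measurable_fst borel_measurable_integrable[OF int[OF M]]]
              measurable_compose[OF measurable_snd borel_measurable_integrable[OF int[OF zero_less_one]]]])
    qed
    then show ?thesis
      by (subst lborel_pair.integral_fst'[symmetric]) simp_all
  qed
  also have "\<dots> = of_real (sqrt (2 * pi) / M * exp (- (((\<tau> - \<omega>) / M)\<^sup>2 / 2)))
      * of_real (sqrt (2 * pi) / 1 * exp (- (((\<xi> - N) / 1)\<^sup>2 / 2)))"
    using M by (simp only: fourier_transform_packet zero_less_one)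
  also have "\<dots> = of_real ((sqrt (2 * pi) * sqrt (2 * pi)) / M * exp (- (((\<tau> - \<omega>) / M)\<^sup>2 / 2)) * exp (- ((\<xi> - N)\<^sup>2 / 2)))"
    by (simp del: real_sqrt_mult_self)
  finally show ?thesis by simp
qed

text \<open>The oscillating factors have modulus one, so only the Gaussian envelopes contribute.\<close>

lemma L2_norm_wave_mult:
  assumes M: "0 < M"
  shows "L2_norm (\<lambda>z. wave M N \<omega> z * wave M N' \<omega>' z) = ennreal (sqrt (pi / (2 * M)))"
proof -
  have "(\<integral>\<^sup>+ z. ennreal ((cmod (wave M N \<omega> z * wave M N' \<omega>' z))\<^sup>2) \<partial>lborel)
     = (\<integral>\<^sup>+ (t, x). ennreal (exp (- ((t - 0)\<^sup>2 / (2 * (1 / (2 * M))\<^sup>2))) * exp (- ((x - 0)\<^sup>2 / (2 * (1 / 2)\<^sup>2)))) \<partial>lborel)"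
    by (intro nn_integral_cong)
       (auto simp: wave_def norm_mult norm_packet power2_eq_square mult_exp_exp field_simps)
  also have "\<dots> = ennreal (pi / (2 * M))"
    using M by (subst nn_integral_gaussian_product) (auto simp: field_simps)
  finally show ?thesis
    using M by (simp add: L2_norm_def)
qed

lemma L2_norm_le:
  assumes "(\<integral>\<^sup>+ z. ennreal ((cmod (f z))\<^sup>2) \<partial>lborel) \<le> ennreal (B\<^sup>2)" "0 \<le> B"
  shows "L2_norm f \<le> ennreal B"
proof -
  have "enn2real (\<integral>\<^sup>+ z. ennreal ((cmod (f z))\<^sup>2) \<partial>lborel) \<le> B\<^sup>2"
    using assms by (intro enn2real_leI) auto
  then have "sqrt (enn2real (\<integral>\<^sup>+ z. ennreal ((cmod (f z))\<^sup>2) \<partial>lborel)) \<le> B"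
    using assms by (intro real_le_lsqrt) auto
  then show ?thesis
    using assms by (auto simp: L2_norm_def Let_def ennreal_leI top_unique)
qed

section \<open>The Bourgain norm of a wave packet\<close>

lemma bracket_frequency:
  "N \<le> bracket \<xi> * bracket (\<xi> - N)"
proof -
  have "N \<le> \<bar>\<xi>\<bar> + \<bar>\<xi> - N\<bar>" by simp
  also have "\<dots> \<le> (1 + \<bar>\<xi>\<bar>) * (1 + \<bar>\<xi> - N\<bar>)" by (simp add: algebra_simps)
  finally show ?thesis by (simp add: bracket_def)
qed

text \<open>On the Fourier side a packet lives where \<open>y = (\<tau> - \<alpha> N\<^sup>3) / M\<close> and \<open>z = \<xi> - N\<close> are of
  order one. There \<open>\<tau> - \<alpha> \<xi>\<^sup>3 = M y - \<alpha> (3 N\<^sup>2 z + 3 N z\<^sup>2 + z\<^sup>3)\<close> is at most of the size of the larger of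
  \<open>M\<close> and \<open>N\<^sup>2\<close>, up to a polynomial loss in \<open>y\<close> and \<open>z\<close>.\<close>

lemma bracket_modulation:
  fixes \<alpha> :: real
  assumes M: "1 \<le> M" "M \<le> Q" and N: "1 \<le> N" "N\<^sup>2 \<le> Q"
  shows "bracket (\<tau> - \<alpha> * \<xi> ^ 3)
    \<le> (1 + \<bar>\<alpha>\<bar>) * Q * bracket ((\<tau> - \<alpha> * N ^ 3) / M) * bracket (\<xi> - N) ^ 3"
proof -
  define y where "y = (\<tau> - \<alpha> * N ^ 3) / M"
  define z where "z = \<xi> - N"
  have Q: "1 \<le> Q" "N \<le> Q"
    using M N self_le_power[of N 2] by auto
  have "M * y = \<tau> - \<alpha> * N ^ 3"
    using M by (simp add: y_def)
  then have 1: "\<tau> - \<alpha> * \<xi> ^ 3 = M * y - \<alpha> * (3 * N\<^sup>2 * z + 3 * N * z\<^sup>2 + z ^ 3)"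
    by (simp add: z_def power2_eq_square power3_eq_cube algebra_simps)
  have 2: "\<bar>3 * N\<^sup>2 * z + 3 * N * z\<^sup>2 + z ^ 3\<bar> \<le> Q * (1 + \<bar>z\<bar>) ^ 3"
  proof -
    have "\<bar>3 * N\<^sup>2 * z + 3 * N * z\<^sup>2 + z ^ 3\<bar> \<le> \<bar>3 * N\<^sup>2 * z\<bar> + \<bar>3 * N * z\<^sup>2\<bar> + \<bar>z ^ 3\<bar>"
      by linarith
    also have "\<dots> = 3 * (N\<^sup>2 * \<bar>z\<bar>) + 3 * (N * \<bar>z\<bar>\<^sup>2) + 1 * \<bar>z\<bar> ^ 3"
      using N by (simp add: abs_mult power_abs)
    also have "\<dots> \<le> 3 * (Q * \<bar>z\<bar>) + 3 * (Q * \<bar>z\<bar>\<^sup>2) + Q * \<bar>z\<bar> ^ 3"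
      using N Q by (intro add_mono mult_left_mono mult_right_mono) auto
    also have "\<dots> \<le> Q * (1 + \<bar>z\<bar>) ^ 3"
      using Q by (simp add: power2_eq_square power3_eq_cube algebra_simps)
    finally show ?thesis .
  qed
  have "\<bar>\<tau> - \<alpha> * \<xi> ^ 3\<bar> \<le> \<bar>M * y\<bar> + \<bar>\<alpha> * (3 * N\<^sup>2 * z + 3 * N * z\<^sup>2 + z ^ 3)\<bar>"
    unfolding 1 by linarith
  also have "\<dots> \<le> Q * \<bar>y\<bar> + \<bar>\<alpha>\<bar> * (Q * (1 + \<bar>z\<bar>) ^ 3)"
    unfolding abs_mult[of M] abs_mult[of \<alpha>]
    using M 2 by (intro add_mono mult_mono) auto
  finally have "bracket (\<tau> - \<alpha> * \<xi> ^ 3) \<le> Q * (1 + \<bar>y\<bar>) * 1 + \<bar>\<alpha>\<bar> * Q * 1 * (1 + \<bar>z\<bar>) ^ 3"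
    using Q by (simp add: bracket_def algebra_simps)
  also have "\<dots> \<le> Q * (1 + \<bar>y\<bar>) * (1 + \<bar>z\<bar>) ^ 3 + \<bar>\<alpha>\<bar> * Q * (1 + \<bar>y\<bar>) * (1 + \<bar>z\<bar>) ^ 3"
    using Q by (intro add_mono mult_mono) auto
  also have "\<dots> = (1 + \<bar>\<alpha>\<bar>) * Q * bracket y * bracket z ^ 3"
    by (simp add: bracket_def algebra_simps)
  finally show ?thesis
    by (simp add: y_def z_def)
qed

lemma L2_norm_mono:
  assumes "\<And>z. cmod (f z) \<le> cmod (g z)"
  shows "L2_norm f \<le> L2_norm g"
proof -
  have I: "(\<integral>\<^sup>+ z. ennreal ((cmod (f z))\<^sup>2) \<partial>lborel) \<le> (\<integral>\<^sup>+ z. ennreal ((cmod (g z))\<^sup>2) \<partial>lborel)"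
    using assms by (intro nn_integral_mono ennreal_leI power_mono) auto
  show ?thesis
  proof (cases "(\<integral>\<^sup>+ z. ennreal ((cmod (g z))\<^sup>2) \<partial>lborel) = \<infinity>")
    case True
    then show ?thesis by (simp add: L2_norm_def)
  next
    case False
    with I have "(\<integral>\<^sup>+ z. ennreal ((cmod (f z))\<^sup>2) \<partial>lborel) \<noteq> \<infinity>"
      by (auto simp: top_unique)
    with False I show ?thesis
      by (auto simp: L2_norm_def Let_def top.not_eq_extremum intro!: ennreal_leI enn2real_mono)
  qed
qed

lemma X_norm_mono:
  assumes "b \<le> b'"
  shows "X_norm \<alpha> s b f \<le> X_norm \<alpha> s b' f"
  unfolding X_norm_def
proof (rule L2_norm_mono, clarify)
  fix \<tau> \<xi>
  have "bracket (\<tau> - \<alpha> * \<xi> ^ 3) powr b \<le> bracket (\<tau> - \<alpha> * \<xi> ^ 3) powr b'"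
    using assms bracket_ge_1 by (intro powr_mono)
  then show "cmod (complex_of_real (bracket \<xi> powr s * bracket (\<tau> - \<alpha> * \<xi> ^ 3) powr b) * fourier f (\<tau>, \<xi>))
    \<le> cmod (complex_of_real (bracket \<xi> powr s * bracket (\<tau> - \<alpha> * \<xi> ^ 3) powr b') * fourier f (\<tau>, \<xi>))"
    unfolding norm_mult norm_of_real abs_mult
    by (intro mult_right_mono mult_left_mono) auto
qed

text \<open>The frequency weight contributes \<open>N powr (- 1/2)\<close>, the modulation weight \<open>Q powr b\<close>, and the
  \<open>L\<^sup>2\<close> norm of the packet \<open>M powr (- 1/2)\<close>. The losses in the two weights are polynomial in the
  normalised Fourier variables, so the Gaussian tails absorb them. The assumption \<open>0 \<le> b\<close> makes
  the upper bound on the modulation an upper bound on its weight. With \<open>Q\<close> separate from \<open>M\<close> and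
  \<open>N\<^sup>2\<close>, the bound applies both to short packets, \<open>M = N\<^sup>2\<close>, and to those of unit duration, \<open>M = 1\<close>.\<close>

lemma X_norm_wave_le:
  fixes \<alpha> b :: real
  assumes b: "0 \<le> b"
  shows "\<exists>K>0. \<forall>M N Q. 1 \<le> M \<longrightarrow> M \<le> Q \<longrightarrow> 1 \<le> N \<longrightarrow> N\<^sup>2 \<le> Q \<longrightarrow>
    X_norm \<alpha> (- 1 / 2) b (wave M N (\<alpha> * N ^ 3)) \<le> ennreal (K * (N powr (- 1 / 2) * Q powr b * M powr (- 1 / 2)))"
proof -
  obtain A where A: "0 < A" "\<And>y. bracket y powr b * exp (- (y\<^sup>2 / 2)) \<le> A * exp (- (y\<^sup>2 / 4))"
    using bracket_powr_times_gaussian_le[of b] by blast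
  obtain B where B: "0 < B" "\<And>z. bracket z powr (1 / 2 + 3 * b) * exp (- (z\<^sup>2 / 2)) \<le> B * exp (- (z\<^sup>2 / 4))"
    using bracket_powr_times_gaussian_le[of "1 / 2 + 3 * b"] by blast
  define K where "K = 2 * pi * (1 + \<bar>\<alpha>\<bar>) powr b * A * B"
  have K: "0 < K"
    using A B by (simp add: K_def)
  have "X_norm \<alpha> (- 1 / 2) b (wave M N (\<alpha> * N ^ 3))
      \<le> ennreal (sqrt (2 * pi) * K * (N powr (- 1 / 2) * Q powr b * M powr (- 1 / 2)))"
    if M: "1 \<le> M" "M \<le> Q" and N: "1 \<le> N" "N\<^sup>2 \<le> Q" for M N Q
  proof -
    let ?L = "K * N powr (- 1 / 2) * Q powr b / M"
    let ?F = "\<lambda>(\<tau>, \<xi>). complex_of_real (bracket \<xi> powr (- 1 / 2) * bracket (\<tau> - \<alpha> * \<xi> ^ 3) powr b)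
      * fourier (wave M N (\<alpha> * N ^ 3)) (\<tau>, \<xi>)"
    have pointwise: "cmod (?F (\<tau>, \<xi>))
      \<le> ?L * (exp (- (((\<tau> - \<alpha> * N ^ 3) / M)\<^sup>2 / 4)) * exp (- ((\<xi> - N)\<^sup>2 / 4)))" for \<tau> \<xi>
    proof -
      define y where "y = (\<tau> - \<alpha> * N ^ 3) / M"
      define z where "z = \<xi> - N"
      have pos: "0 < bracket x" for x
        using bracket_ge_1[of x] by linarith
      have "bracket \<xi> powr (- 1 / 2) \<le> (N / bracket z) powr (- 1 / 2)"
        using bracket_frequency[of N \<xi>] N pos[of z] pos[of \<xi>]
        by (intro powr_mono2') (auto simp: z_def field_simps)
      also have "\<dots> = N powr (- 1 / 2) * bracket z powr (1 / 2)"
        using N pos[of z] by (simp add: powr_divide powr_minus_divide)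
      finally have freq: "bracket \<xi> powr (- 1 / 2) \<le> N powr (- 1 / 2) * bracket z powr (1 / 2)" .
      have "bracket (\<tau> - \<alpha> * \<xi> ^ 3) powr b \<le> ((1 + \<bar>\<alpha>\<bar>) * Q * bracket y * bracket z ^ 3) powr b"
        using bracket_modulation[OF M N, of \<tau> \<alpha> \<xi>] b pos[of "\<tau> - \<alpha> * \<xi> ^ 3"]
        by (intro powr_mono2) (auto simp: y_def z_def)
      also have "\<dots> = (1 + \<bar>\<alpha>\<bar>) powr b * Q powr b * bracket y powr b * bracket z powr (3 * b)"
        using M pos[of y] pos[of z]
        by (simp add: powr_mult powr_powr powr_realpow[symmetric] del: powr_numeral)
      finally have "bracket (\<tau> - \<alpha> * \<xi> ^ 3) powr b
        \<le> (1 + \<bar>\<alpha>\<bar>) powr b * Q powr b * bracket y powr b * bracket z powr (3 * b)" .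
      with freq have "bracket \<xi> powr (- 1 / 2) * bracket (\<tau> - \<alpha> * \<xi> ^ 3) powr b
        \<le> (N powr (- 1 / 2) * bracket z powr (1 / 2))
          * ((1 + \<bar>\<alpha>\<bar>) powr b * Q powr b * bracket y powr b * bracket z powr (3 * b))"
        by (intro mult_mono) auto
      also have "\<dots> = (1 + \<bar>\<alpha>\<bar>) powr b * N powr (- 1 / 2) * Q powr b
          * (bracket y powr b * bracket z powr (1 / 2 + 3 * b))"
        by (simp add: powr_add mult_ac)
      finally have "bracket \<xi> powr (- 1 / 2) * bracket (\<tau> - \<alpha> * \<xi> ^ 3) powr b
          * (2 * pi / M * exp (- (y\<^sup>2 / 2)) * exp (- (z\<^sup>2 / 2)))
        \<le> (1 + \<bar>\<alpha>\<bar>) powr b * N powr (- 1 / 2) * Q powr b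
          * (bracket y powr b * bracket z powr (1 / 2 + 3 * b)) * (2 * pi / M * exp (- (y\<^sup>2 / 2)) * exp (- (z\<^sup>2 / 2)))"
        using M by (intro mult_right_mono) auto
      also have "\<dots> = (1 + \<bar>\<alpha>\<bar>) powr b * N powr (- 1 / 2) * Q powr b * (2 * pi / M)
          * ((bracket y powr b * exp (- (y\<^sup>2 / 2))) * (bracket z powr (1 / 2 + 3 * b) * exp (- (z\<^sup>2 / 2))))"
        by (simp add: mult_ac)
      also have "\<dots> \<le> (1 + \<bar>\<alpha>\<bar>) powr b * N powr (- 1 / 2) * Q powr b * (2 * pi / M)
          * ((A * exp (- (y\<^sup>2 / 4))) * (B * exp (- (z\<^sup>2 / 4))))"
        using A(1) B(1) M by (intro mult_left_mono mult_mono A(2) B(2)) auto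
      also have "\<dots> = ?L * (exp (- (y\<^sup>2 / 4)) * exp (- (z\<^sup>2 / 4)))"
        by (simp add: K_def mult_ac)
      finally have le: "bracket \<xi> powr (- 1 / 2) * bracket (\<tau> - \<alpha> * \<xi> ^ 3) powr b
          * (2 * pi / M * exp (- (y\<^sup>2 / 2)) * exp (- (z\<^sup>2 / 2)))
        \<le> ?L * (exp (- (y\<^sup>2 / 4)) * exp (- (z\<^sup>2 / 4)))" .
      have "cmod (?F (\<tau>, \<xi>)) = bracket \<xi> powr (- 1 / 2) * bracket (\<tau> - \<alpha> * \<xi> ^ 3) powr b
          * (2 * pi / M * exp (- (y\<^sup>2 / 2)) * exp (- (z\<^sup>2 / 2)))"
        using M unfolding y_def z_def
        by (simp only: prod.case fourier_wave norm_mult norm_of_real) (simp add: abs_mult fourier_wave)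
      with le show ?thesis
        by (simp add: y_def z_def)
    qed
    have "(\<integral>\<^sup>+ p. ennreal ((cmod (?F p))\<^sup>2) \<partial>lborel)
      \<le> (\<integral>\<^sup>+ p. ennreal (?L\<^sup>2) * (case p of (\<tau>, \<xi>) \<Rightarrow>
            ennreal (exp (- ((\<tau> - \<alpha> * N ^ 3)\<^sup>2 / (2 * M\<^sup>2))) * exp (- ((\<xi> - N)\<^sup>2 / (2 * 1\<^sup>2))))) \<partial>lborel)"
    proof (rule nn_integral_mono, unfold split_paired_all)
      fix \<tau> \<xi> :: real
      have "(cmod (?F (\<tau>, \<xi>)))\<^sup>2
        \<le> (?L * (exp (- (((\<tau> - \<alpha> * N ^ 3) / M)\<^sup>2 / 4)) * exp (- ((\<xi> - N)\<^sup>2 / 4))))\<^sup>2"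
        by (rule power_mono[OF pointwise norm_ge_zero])
      also have "\<dots> = ?L\<^sup>2 * (exp (- ((\<tau> - \<alpha> * N ^ 3)\<^sup>2 / (2 * M\<^sup>2))) * exp (- ((\<xi> - N)\<^sup>2 / (2 * 1\<^sup>2))))"
        by (simp add: power_mult_distrib exp_double[symmetric] power_divide)
      finally have "ennreal ((cmod (?F (\<tau>, \<xi>)))\<^sup>2) \<le> ennreal (?L\<^sup>2 *
            (exp (- ((\<tau> - \<alpha> * N ^ 3)\<^sup>2 / (2 * M\<^sup>2))) * exp (- ((\<xi> - N)\<^sup>2 / (2 * 1\<^sup>2)))))"
        by (rule ennreal_leI)
      then show "ennreal ((cmod (?F (\<tau>, \<xi>)))\<^sup>2) \<le> ennreal (?L\<^sup>2) * (case (\<tau>, \<xi>) of (\<tau>, \<xi>) \<Rightarrow>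
            ennreal (exp (- ((\<tau> - \<alpha> * N ^ 3)\<^sup>2 / (2 * M\<^sup>2))) * exp (- ((\<xi> - N)\<^sup>2 / (2 * 1\<^sup>2)))))"
        by (simp only: prod.case ennreal_mult' zero_le_power2)
    qed
    also have "\<dots> = ennreal (?L\<^sup>2) * ennreal (2 * pi * M * 1)"
    proof -
      have "(\<lambda>p. case p of (\<tau>, \<xi>) \<Rightarrow>
          ennreal (exp (- ((\<tau> - \<alpha> * N ^ 3)\<^sup>2 / (2 * M\<^sup>2))) * exp (- ((\<xi> - N)\<^sup>2 / (2 * 1\<^sup>2)))))
          \<in> borel_measurable lborel"
        unfolding case_prod_unfold measurable_lborel2
      proof (intro measurable_compose[OF _ measurable_ennreal] borel_measurable_continuous_onI)
        show "continuous_on UNIV (\<lambda>p :: real \<times> real.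
            exp (- ((fst p - \<alpha> * N ^ 3)\<^sup>2 / (2 * M\<^sup>2))) * exp (- ((snd p - N)\<^sup>2 / (2 * 1\<^sup>2))))"
          using M by (auto intro!: continuous_intros)
      qed
      moreover have "0 < M" using M by simp
      ultimately show ?thesis
        by (simp only: nn_integral_cmult nn_integral_gaussian_product zero_less_one)
    qed
    also have "\<dots> = ennreal ((sqrt (2 * pi) * K * (N powr (- 1 / 2) * Q powr b * M powr (- 1 / 2)))\<^sup>2)"
    proof -
      have "(M powr (- 1 / 2))\<^sup>2 = 1 / M"
        using M by (simp only: power2_eq_square powr_add[symmetric]) (simp add: powr_minus_divide)
      then show ?thesis
        using M by (simp add: ennreal_mult[symmetric] power_mult_distrib power_divide power2_eq_square[of M])
    qed
    finally show ?thesis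
      unfolding X_norm_def using K by (intro L2_norm_le) auto
  qed
  with K show ?thesis
    by (intro exI[of _ "sqrt (2 * pi) * K"]) auto
qed

section \<open>Failure of the bilinear estimate\<close>

lemma no_positive_lower_bound:
  fixes c D \<delta> :: real
  assumes "0 < c" "0 < \<delta>" and le: "\<And>N. 1 \<le> N \<Longrightarrow> c \<le> D * N powr (- \<delta>)"
  shows False
proof -
  have "((\<lambda>N. D * N powr (- \<delta>)) \<longlongrightarrow> D * 0) at_top"
    using assms by (intro tendsto_intros tendsto_neg_powr filterlim_ident) auto
  moreover have "eventually (\<lambda>N. c \<le> D * N powr (- \<delta>)) at_top"
    using eventually_ge_at_top[of 1] by eventually_elim (rule le)
  ultimately have "c \<le> D * 0"
    by (intro tendsto_lowerbound) auto
  with assms show False by simp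
qed

lemma estimate_on_waves:
  assumes est: "\<And>u v. schwartz u \<Longrightarrow> schwartz v \<Longrightarrow>
      L2_norm (\<lambda>z. u z * v z) \<le> ennreal C * X_norm \<alpha> s b u * X_norm \<beta> s' b' v"
    and M: "0 < M" and C: "0 \<le> C"
    and U: "X_norm \<alpha> s b (wave M N \<omega>) \<le> ennreal U" "0 \<le> U"
    and V: "X_norm \<beta> s' b' (wave M N' \<omega>') \<le> ennreal V" "0 \<le> V"
  shows "sqrt (pi / 2) * M powr (- 1 / 2) \<le> C * U * V"
proof -
  have "ennreal (sqrt (pi / (2 * M)))
      \<le> ennreal C * X_norm \<alpha> s b (wave M N \<omega>) * X_norm \<beta> s' b' (wave M N' \<omega>')"
    using est[of "wave M N \<omega>" "wave M N' \<omega>'"] M by (simp add: schwartz_wave L2_norm_wave_mult)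
  also have "\<dots> \<le> ennreal C * ennreal U * ennreal V"
    using U V by (intro mult_mono) auto
  also have "\<dots> = ennreal (C * U * V)"
    using C U V by (simp add: ennreal_mult)
  finally have "sqrt (pi / (2 * M)) \<le> C * U * V"
    using C U V by (simp add: ennreal_le_iff)
  moreover have "sqrt (pi / (2 * M)) = sqrt (pi / 2) * M powr (- 1 / 2)"
    using M by (simp add: real_sqrt_divide real_sqrt_mult powr_minus_divide powr_half_sqrt)
  ultimately show ?thesis by simp
qed

theorem proposition6p2:
  fixes \<alpha> :: real
  assumes "\<alpha> \<noteq> 0" and "\<alpha> \<noteq> 1"
  shows "\<forall>\<epsilon>>0. \<not> (\<exists>C::real. C > 0 \<and>
    (\<forall>u v. schwartz u \<longrightarrow> schwartz v \<longrightarrow>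
      L2_norm (\<lambda>z. u z * v z)
        \<le> ennreal C * X_norm \<alpha> (- 1 / 2) (1 / 2 - 2 * \<epsilon>) u * X_norm 1 (- 1 / 2) (1 / 2 + \<epsilon>) v))"
proof (intro allI impI notI, elim exE conjE)
  fix \<epsilon> C :: real
  assume \<epsilon>: "0 < \<epsilon>" and C: "0 < C"
    and "\<forall>u v. schwartz u \<longrightarrow> schwartz v \<longrightarrow> L2_norm (\<lambda>z. u z * v z)
        \<le> ennreal C * X_norm \<alpha> (- 1 / 2) (1 / 2 - 2 * \<epsilon>) u * X_norm 1 (- 1 / 2) (1 / 2 + \<epsilon>) v"
  then have est: "L2_norm (\<lambda>z. u z * v z)
      \<le> ennreal C * X_norm \<alpha> (- 1 / 2) (1 / 2 - 2 * \<epsilon>) u * X_norm 1 (- 1 / 2) (1 / 2 + \<epsilon>) v"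
    if "schwartz u" "schwartz v" for u v
    using that by blast
  \<comment> \<open>packets with small modulation would spoil an upper bound for a negative exponent, so \<open>0\<close> replaces it\<close>
  define b where "b = max 0 (1 / 2 - 2 * \<epsilon>)"
  have "0 \<le> b" by (simp add: b_def)
  then obtain K where K: "0 < K" and K_bound: "\<forall>M N Q. 1 \<le> M \<longrightarrow> M \<le> Q \<longrightarrow> 1 \<le> N \<longrightarrow> N\<^sup>2 \<le> Q \<longrightarrow>
      X_norm \<alpha> (- 1 / 2) b (wave M N (\<alpha> * N ^ 3)) \<le> ennreal (K * (N powr (- 1 / 2) * Q powr b * M powr (- 1 / 2)))"
    using X_norm_wave_le by blast
  have U: "X_norm \<alpha> (- 1 / 2) (1 / 2 - 2 * \<epsilon>) (wave M N (\<alpha> * N ^ 3))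
      \<le> ennreal (K * (N powr (- 1 / 2) * Q powr b * M powr (- 1 / 2)))"
    if "1 \<le> M" "M \<le> Q" "1 \<le> N" "N\<^sup>2 \<le> Q" for M N Q
  proof (rule order_trans)
    show "X_norm \<alpha> (- 1 / 2) (1 / 2 - 2 * \<epsilon>) (wave M N (\<alpha> * N ^ 3)) \<le> X_norm \<alpha> (- 1 / 2) b (wave M N (\<alpha> * N ^ 3))"
      by (rule X_norm_mono) (simp add: b_def)
  qed (use that K_bound in blast)
  have "0 \<le> 1 / 2 + \<epsilon>" using \<epsilon> by simp
  then obtain L where L: "0 < L" and "\<forall>M N Q. 1 \<le> M \<longrightarrow> M \<le> Q \<longrightarrow> 1 \<le> N \<longrightarrow> N\<^sup>2 \<le> Q \<longrightarrow>
      X_norm 1 (- 1 / 2) (1 / 2 + \<epsilon>) (wave M N (1 * N ^ 3))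
        \<le> ennreal (L * (N powr (- 1 / 2) * Q powr (1 / 2 + \<epsilon>) * M powr (- 1 / 2)))"
    using X_norm_wave_le by blast
  then have V: "X_norm 1 (- 1 / 2) (1 / 2 + \<epsilon>) (wave M N (1 * N ^ 3))
      \<le> ennreal (L * (N powr (- 1 / 2) * Q powr (1 / 2 + \<epsilon>) * M powr (- 1 / 2)))"
    if "1 \<le> M" "M \<le> Q" "1 \<le> N" "N\<^sup>2 \<le> Q" for M N Q
    using that by blast
  show False
  proof (cases "\<epsilon> < 1 / 4")
    case True
    \<comment> \<open>both packets have duration \<open>N\<^sup>-\<^sup>2\<close>, so \<open>M = Q = N\<^sup>2\<close> for each of them\<close>
    then have b: "b = 1 / 2 - 2 * \<epsilon>" by (simp add: b_def)
    show False
    proof (rule no_positive_lower_bound)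
      fix N :: real
      assume N: "1 \<le> N"
      then have N2: "1 \<le> N\<^sup>2" by simp
      have sq: "(N\<^sup>2) powr r = N powr (2 * r)" for r
        using N by (simp add: powr_powr powr_numeral[symmetric] del: powr_numeral)
      have "sqrt (pi / 2) * (N\<^sup>2) powr (- 1 / 2)
        \<le> C * (K * (N powr (- 1 / 2) * (N\<^sup>2) powr b * (N\<^sup>2) powr (- 1 / 2)))
            * (L * (N powr (- 1 / 2) * (N\<^sup>2) powr (1 / 2 + \<epsilon>) * (N\<^sup>2) powr (- 1 / 2)))"
        using K L C N2
        by (intro estimate_on_waves[OF est _ _ U[OF N2 order_refl N order_refl] _ V[OF N2 order_refl N order_refl]]) auto
      also have "\<dots> = C * K * L * (N powr (- 1 - 2 * \<epsilon>))"
      proof -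
        have "(N powr (- 1 / 2) * (N\<^sup>2) powr b * (N\<^sup>2) powr (- 1 / 2))
            * (N powr (- 1 / 2) * (N\<^sup>2) powr (1 / 2 + \<epsilon>) * (N\<^sup>2) powr (- 1 / 2)) = N powr (- 1 - 2 * \<epsilon>)"
          unfolding sq powr_add[symmetric] by (simp add: b algebra_simps)
        then show ?thesis by (metis (no_types, opaque_lifting) mult.assoc mult.left_commute)
      qed
      finally have "sqrt (pi / 2) * N powr (- 1) * N powr 1 \<le> C * K * L * N powr (- 1 - 2 * \<epsilon>) * N powr 1"
        unfolding sq by (intro mult_right_mono) auto
      then show "sqrt (pi / 2) \<le> C * K * L * N powr (- (2 * \<epsilon>))"
        using N unfolding mult.assoc powr_add[symmetric] by simp
    qed (use \<epsilon> in auto)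
  next
    case False
    \<comment> \<open>both packets have duration \<open>1\<close>; \<open>v\<close> has frequency \<open>1\<close> and only \<open>u\<close> varies with \<open>N\<close>\<close>
    then have b: "b = 0" by (simp add: b_def)
    show False
    proof (rule no_positive_lower_bound)
      fix N :: real
      assume N: "1 \<le> N"
      then have N2: "1 \<le> N\<^sup>2" by simp
      have "sqrt (pi / 2) * 1 powr (- 1 / 2)
        \<le> C * (K * (N powr (- 1 / 2) * (N\<^sup>2) powr b * 1 powr (- 1 / 2)))
            * (L * (1 powr (- 1 / 2) * 1 powr (1 / 2 + \<epsilon>) * 1 powr (- 1 / 2)))"
        using K L C
        by (intro estimate_on_waves[OF est _ _ U[OF order_refl N2 N order_refl] _
              V[OF order_refl order_refl order_refl]]) auto
      then show "sqrt (pi / 2) \<le> C * K * L * N powr (- (1 / 2))"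
        using N by (simp add: b mult_ac)
    qed auto
  qed
qed

end
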